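(* Let $k$ be a field and let $\mathfrak{L}$ and $\mathfrak{g}$ be two $k$-vector spaces viewed with the abelian Leibniz algebra structures $\mathfrak{L}_0$ and $\mathfrak{g}_0$. Then $$\mathbb{HL}^2(\mathfrak{L}_0,\mathfrak{g}_0) = \bigsqcup_{(\triangleleft,\triangleright)} DHL^2_{(\triangleleft,\triangleright)}(\mathfrak{L},\mathfrak{g}),$$ where the coproduct on the right-hand side is in the category of sets (disjoint union), over all pairs $(\triangleleft,\triangleright)$ such that $(\mathfrak{g},\triangleleft,\triangleright)$ is a discrete representation of $\mathfrak{L}$.
   Context: All vector spaces and (bi)linear maps are over an arbitrary field $k$. A Leibniz algebra is a vector space with a bilinear bracket satisfying $[x,[y,z]] = [[x,y],z] - [[x,z],y]$. For a vector space $V$, $V_0$ denotes $V$ with the zero (abelian) bracket. $\mathbb{HL}^2(\mathfrak{L}_0,\mathfrak{g}_0)$: consider all triples $(\triangleleft,\triangleright,f)$ of bilinear maps $\triangleleft : \mathfrak{g}\times\mathfrak{L}\to\mathfrak{g}$, $\triangleright : \mathfrak{L}\times\mathfrak{g}\to\mathfrak{g}$, $f : \mathfrak{L}\times\mathfrak{L}\to\mathfrak{g}$ such that $\mathfrak{g}\times\mathfrak{L}$ with the bracket $\{(g,x),(h,y)\} := (x\triangleright h + g\triangleleft y + f(x,y), 0)$ is a Leibniz algebra. Two such triples are cohomologous, $(\triangleleft,\triangleright,f)\approx(\triangleleft',\triangleright',f')$, iff $\triangleleft=\triangleleft'$, $\triangleright=\triangleright'$ and there is a linear map $r:\mathfrak{L}\to\mathfrak{g}$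 with $$f(x,y) = f'(x,y) + x\triangleright' r(y) + r(x)\triangleleft' y \quad ( * )$$ for all $x,y\in\mathfrak{L}$. $\mathbb{HL}^2(\mathfrak{L}_0,\mathfrak{g}_0)$ is the set of equivalence classes. A discrete representation of the vector space $\mathfrak{L}$ is a triple $(\mathfrak{g},\triangleleft,\triangleright)$ of a vector space $\mathfrak{g}$ and bilinear maps $\triangleleft : \mathfrak{g}\times\mathfrak{L}\to\mathfrak{g}$, $\triangleright : \mathfrak{L}\times\mathfrak{g}\to\mathfrak{g}$ such that for all $g\in\mathfrak{g}$, $x,y\in\mathfrak{L}$: $(g\triangleleft x)\triangleleft y = (g\triangleleft y)\triangleleft x$ and $x\triangleright(g\triangleleft y) = (x\triangleright g)\triangleleft y = -x\triangleright(y\triangleright g)$. For a fixed discrete representation, $DZL^2_{(\triangleleft,\triangleright)}(\mathfrak{L},\mathfrak{g})$ is the set of discrete 2-cocycles, i.e. bilinear maps $f:\mathfrak{L}\times\mathfrak{L}\to\mathfrak{g}$ with $x\triangleright f(y,z) = f(x,y)\triangleleft z - f(x,z)\triangleleft y$ for all $x,y,z\in\mathfrak{L}$. Two discrete cocycles $f,f'$ are equivalent if there is a linear $r:\mathfrak{L}\to\mathfrak{g}$ satisfying $( * )$ (with $\triangleleft'=\triangleleft$, $\triangleright'=\triangleright$), and $DHL^2_{(\triangleleft,\triangleright)}(\mathfrak{L},\mathfrak{g})$ is the quotient set. The equality is the canonical identification sending the class of $f$ in the component indexed by $(\triangleleft,\triangleright)$ to the class of $(\triangleleft,\triangleright,f)$.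 *)

theory Defs
  imports "HOL-Analysis.Product_Vector"
begin

definition bilinear_map ::
  "('k::field \<Rightarrow> 'a::ab_group_add \<Rightarrow> 'a) \<Rightarrow> ('k \<Rightarrow> 'b::ab_group_add \<Rightarrow> 'b)
    \<Rightarrow> ('k \<Rightarrow> 'c::ab_group_add \<Rightarrow> 'c) \<Rightarrow> ('a \<Rightarrow> 'b \<Rightarrow> 'c) \<Rightarrow> bool"
  where "bilinear_map sA sB sC B \<longleftrightarrow>
    (\<forall>x. Vector_Spaces.linear sB sC (\<lambda>y. B x y)) \<and>
    (\<forall>y. Vector_Spaces.linear sA sC (\<lambda>x. B x y))"

locale leibniz_algebra = vector_space scale
  for scale :: "'k::field \<Rightarrow> 'a::ab_group_add \<Rightarrow> 'a" +
  fixes bracket :: "'a \<Rightarrow> 'a \<Rightarrow> 'a"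
  assumes bilinear_bracket: "bilinear_map scale scale scale bracket"
    and leibniz_identity:
      "bracket x (bracket y z) = bracket (bracket x y) z - bracket (bracket x z) y"

text \<open>
  Throughout, \<open>sL\<close> and \<open>sG\<close> are the scalar multiplications of the vector spaces
  \<open>\<LL>\<close> and \<open>\<gg>\<close>, which are carried by the types \<open>'l\<close> and \<open>'g\<close>. A pair or triple
  of maps is ordered as the left-pointing action \<open>la :: \<gg> \<times> \<LL> \<rightarrow> \<gg>\<close>,
  the right-pointing action \<open>ra :: \<LL> \<times> \<gg> \<rightarrow> \<gg>\<close>, and \<open>f :: \<LL> \<times> \<LL> \<rightarrow> \<gg>\<close>,
  all in curried form.
\<close>

type_synonym ('l, 'g) actions = "('g \<Rightarrow> 'l \<Rightarrow> 'g) \<times> ('l \<Rightarrow> 'g \<Rightarrow> 'g)"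
type_synonym ('l, 'g) cochain2 = "'l \<Rightarrow> 'l \<Rightarrow> 'g"
type_synonym ('l, 'g) datum = "('g \<Rightarrow> 'l \<Rightarrow> 'g) \<times> ('l \<Rightarrow> 'g \<Rightarrow> 'g) \<times> ('l \<Rightarrow> 'l \<Rightarrow> 'g)"

text \<open>
  The general bracket on \<open>\<gg> \<times> \<LL>\<close> also adds the brackets of \<open>\<gg>\<close> and \<open>\<LL>\<close> in the
  respective components; here those of \<open>\<LL>\<^sub>0\<close> and \<open>\<gg>\<^sub>0\<close> are zero.
\<close>
definition extension_bracket ::
  "('g \<Rightarrow> 'l \<Rightarrow> 'g) \<Rightarrow> ('l \<Rightarrow> 'g \<Rightarrow> 'g) \<Rightarrow> ('l \<Rightarrow> 'l \<Rightarrow> 'g)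
    \<Rightarrow> 'g::ab_group_add \<times> 'l::ab_group_add \<Rightarrow> 'g \<times> 'l \<Rightarrow> 'g \<times> 'l"
  where "extension_bracket la ra f = (\<lambda>(g, x) (h, y). (ra x h + la g y + f x y, 0))"

definition ZL2 ::
  "('k::field \<Rightarrow> 'l::ab_group_add \<Rightarrow> 'l) \<Rightarrow> ('k \<Rightarrow> 'g::ab_group_add \<Rightarrow> 'g) \<Rightarrow> ('l, 'g) datum set"
  where "ZL2 sL sG = {(la, ra, f).
    bilinear_map sG sL sG la \<and> bilinear_map sL sG sG ra \<and> bilinear_map sL sL sG f \<and>
    leibniz_algebra (module_prod.scale sG sL) (extension_bracket la ra f)}"

definition cohomologous ::
  "('k::field \<Rightarrow> 'l::ab_group_add \<Rightarrow> 'l) \<Rightarrow> ('k \<Rightarrow> 'g::ab_group_add \<Rightarrow> 'g)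
    \<Rightarrow> ('g \<Rightarrow> 'l \<Rightarrow> 'g) \<Rightarrow> ('l \<Rightarrow> 'g \<Rightarrow> 'g) \<Rightarrow> ('l, 'g) cochain2 \<Rightarrow> ('l, 'g) cochain2 \<Rightarrow> bool"
  where "cohomologous sL sG la ra f f' \<longleftrightarrow>
    (\<exists>r. Vector_Spaces.linear sL sG r \<and>
      (\<forall>x y. f x y = f' x y + ra x (r y) + la (r x) y))"

definition HL2_rel ::
  "('k::field \<Rightarrow> 'l::ab_group_add \<Rightarrow> 'l) \<Rightarrow> ('k \<Rightarrow> 'g::ab_group_add \<Rightarrow> 'g)
    \<Rightarrow> (('l, 'g) datum \<times> ('l, 'g) datum) set"
  where "HL2_rel sL sG = {((la, ra, f), (la', ra', f')).
    (la, ra, f) \<in> ZL2 sL sG \<and> (la', ra', f') \<in> ZL2 sL sG \<and>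
    la = la' \<and> ra = ra' \<and> cohomologous sL sG la' ra' f f'}"

definition HL2 ::
  "('k::field \<Rightarrow> 'l::ab_group_add \<Rightarrow> 'l) \<Rightarrow> ('k \<Rightarrow> 'g::ab_group_add \<Rightarrow> 'g) \<Rightarrow> ('l, 'g) datum set set"
  where "HL2 sL sG = ZL2 sL sG // HL2_rel sL sG"

definition discrete_reps ::
  "('k::field \<Rightarrow> 'l::ab_group_add \<Rightarrow> 'l) \<Rightarrow> ('k \<Rightarrow> 'g::ab_group_add \<Rightarrow> 'g) \<Rightarrow> ('l, 'g) actions set"
  where "discrete_reps sL sG = {(la, ra).
    bilinear_map sG sL sG la \<and> bilinear_map sL sG sG ra \<and>
    (\<forall>g x y. la (la g x) y = la (la g y) x) \<and>
    (\<forall>g x y. ra x (la g y) = la (ra x g) y \<and> la (ra x g) y = - ra x (ra y g))}"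

definition DZL2 ::
  "('k::field \<Rightarrow> 'l::ab_group_add \<Rightarrow> 'l) \<Rightarrow> ('k \<Rightarrow> 'g::ab_group_add \<Rightarrow> 'g)
    \<Rightarrow> ('l, 'g) actions \<Rightarrow> ('l, 'g) cochain2 set"
  where "DZL2 sL sG = (\<lambda>(la, ra). {f. bilinear_map sL sL sG f \<and>
    (\<forall>x y z. ra x (f y z) = la (f x y) z - la (f x z) y)})"

definition DHL2_rel ::
  "('k::field \<Rightarrow> 'l::ab_group_add \<Rightarrow> 'l) \<Rightarrow> ('k \<Rightarrow> 'g::ab_group_add \<Rightarrow> 'g)
    \<Rightarrow> ('l, 'g) actions \<Rightarrow> (('l, 'g) cochain2 \<times> ('l, 'g) cochain2) set"
  where "DHL2_rel sL sG = (\<lambda>(la, ra). {(f, f').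
    f \<in> DZL2 sL sG (la, ra) \<and> f' \<in> DZL2 sL sG (la, ra) \<and> cohomologous sL sG la ra f f'})"

definition DHL2 ::
  "('k::field \<Rightarrow> 'l::ab_group_add \<Rightarrow> 'l) \<Rightarrow> ('k \<Rightarrow> 'g::ab_group_add \<Rightarrow> 'g)
    \<Rightarrow> ('l, 'g) actions \<Rightarrow> ('l, 'g) cochain2 set set"
  where "DHL2 sL sG a = DZL2 sL sG a // DHL2_rel sL sG a"

lemma bilinear_map_simps:
  assumes "bilinear_map sA sB sC B"
  shows "B (x + x') y = B x y + B x' y" "B x (y + y') = B x y + B x y'"
    "B 0 y = 0" "B x 0 = 0" "B (- x) y = - B x y" "B x (- y) = - B x y"
proof -
  have m: "module_hom sB sC (\<lambda>y. B x y)" "module_hom sA sC (\<lambda>x. B x y)" for x y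
    using assms by (auto simp: bilinear_map_def Vector_Spaces.linear_def)
  show "B (x + x') y = B x y + B x' y" "B x (y + y') = B x y + B x y'"
    using module_hom.add[OF m(2)] module_hom.add[OF m(1)] by auto
  show "B 0 y = 0" "B x 0 = 0"
    using module_hom.zero[OF m(2)] module_hom.zero[OF m(1)] by auto
  show "B (- x) y = - B x y" "B x (- y) = - B x y"
    using module_hom.neg[OF m(2)] module_hom.neg[OF m(1)] by auto
qed

lemma
  fixes sL :: "'k::field \<Rightarrow> 'l::ab_group_add \<Rightarrow> 'l" and sG :: "'k \<Rightarrow> 'g::ab_group_add \<Rightarrow> 'g"
  assumes "vector_space sL" and "vector_space sG"
    and la: "bilinear_map sG sL sG la" and ra: "bilinear_map sL sG sG ra"
  shows cohomologous_refl: "cohomologous sL sG la ra f f"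
    and cohomologous_sym: "cohomologous sL sG la ra f f' \<Longrightarrow> cohomologous sL sG la ra f' f"
    and cohomologous_trans: "cohomologous sL sG la ra f f' \<Longrightarrow> cohomologous sL sG la ra f' f''
      \<Longrightarrow> cohomologous sL sG la ra f f''"
proof -
  interpret vector_space_pair sL sG
    using assms by (simp add: vector_space_pair_def)
  note b = bilinear_map_simps[OF la] bilinear_map_simps[OF ra]
  show "cohomologous sL sG la ra f f"
    unfolding cohomologous_def by (rule exI[of _ "\<lambda>_. 0"]) (simp add: b linear_zero)
  show "cohomologous sL sG la ra f' f" if h: "cohomologous sL sG la ra f f'"
  proof -
    obtain r where "Vector_Spaces.linear sL sG r" "\<forall>x y. f x y = f' x y + ra x (r y) + la (r x) y"
      using h unfolding cohomologous_def by blast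
    then show ?thesis
      unfolding cohomologous_def
      by (intro exI[of _ "\<lambda>x. - r x"]) (simp add: b linear_compose_neg)
  qed
  show "cohomologous sL sG la ra f f''"
    if h: "cohomologous sL sG la ra f f'" "cohomologous sL sG la ra f' f''"
  proof -
    obtain r where "Vector_Spaces.linear sL sG r" "\<forall>x y. f x y = f' x y + ra x (r y) + la (r x) y"
      using h unfolding cohomologous_def by blast
    moreover obtain r' where "Vector_Spaces.linear sL sG r'"
      "\<forall>x y. f' x y = f'' x y + ra x (r' y) + la (r' x) y"
      using h unfolding cohomologous_def by blast
    ultimately show ?thesis
      unfolding cohomologous_def
      by (intro exI[of _ "\<lambda>x. r x + r' x"]) (simp add: b linear_compose_add algebra_simps)
  qed
qed

lemma equiv_HL2_rel:
  assumes "vector_space sL" and "vector_space sG"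
  shows "equiv (ZL2 sL sG) (HL2_rel sL sG)"
proof (rule equivI)
  show "HL2_rel sL sG \<subseteq> ZL2 sL sG \<times> ZL2 sL sG"
    by (auto simp: HL2_rel_def)
  show "refl_on (ZL2 sL sG) (HL2_rel sL sG)"
    by (auto simp: refl_on_def HL2_rel_def ZL2_def intro: cohomologous_refl[OF assms])
  show "sym (HL2_rel sL sG)"
    by (auto simp: sym_def HL2_rel_def ZL2_def intro: cohomologous_sym[OF assms])
  show "trans (HL2_rel sL sG)"
    by (auto simp: trans_def HL2_rel_def ZL2_def intro: cohomologous_trans[OF assms])
qed

lemma equiv_DHL2_rel:
  assumes "vector_space sL" and "vector_space sG" and "a \<in> discrete_reps sL sG"
  shows "equiv (DZL2 sL sG a) (DHL2_rel sL sG a)"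
proof -
  obtain la ra where a: "a = (la, ra)" by (cases a)
  have b: "bilinear_map sG sL sG la" "bilinear_map sL sG sG ra"
    using assms(3) by (auto simp: a discrete_reps_def)
  show ?thesis
  proof (rule equivI)
    show "DHL2_rel sL sG a \<subseteq> DZL2 sL sG a \<times> DZL2 sL sG a"
      by (auto simp: a DHL2_rel_def)
    show "refl_on (DZL2 sL sG a) (DHL2_rel sL sG a)"
      by (auto simp: a refl_on_def DHL2_rel_def intro: cohomologous_refl[OF assms(1,2) b])
    show "sym (DHL2_rel sL sG a)"
      by (auto simp: a sym_def DHL2_rel_def intro: cohomologous_sym[OF assms(1,2) b])
    show "trans (DHL2_rel sL sG a)"
      by (auto simp: a trans_def DHL2_rel_def intro: cohomologous_trans[OF assms(1,2) b])
  qed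
qed

end

theory Submission
  imports Defs
begin

text \<open>
  For elements \<open>(g, x)\<close>, \<open>(h, y)\<close>, \<open>(l, z)\<close> of \<open>\<gg> \<times> \<LL>\<close>, every term of the Leibniz identity
  involves exactly one of \<open>g\<close>, \<open>h\<close>, \<open>l\<close> and \<open>f\<close>. Setting \<open>g\<close>, \<open>h\<close>, \<open>l\<close> to zero isolates the
  discrete cocycle condition, and suitable further specializations give the axioms of a discrete
  representation. So the cocycle data are the disjoint union of the discrete cocycles over all
  representations, and cohomologous data have the same actions by definition.
\<close>

lemma bilinear_map_scale:
  assumes "bilinear_map sA sB sC B"
  shows "B x (sB c y) = sC c (B x y)" "B (sA c x) y = sC c (B x y)"
proof -
  have "module_hom sB sC (\<lambda>y. B x y)" "module_hom sA sC (\<lambda>x. B x y)"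
    using assms by (auto simp: bilinear_map_def Vector_Spaces.linear_def)
  then show "B x (sB c y) = sC c (B x y)" "B (sA c x) y = sC c (B x y)"
    by (auto dest: module_hom.scale)
qed

text \<open>Bilinearity of the bracket is automatic, so the Leibniz identity is the only condition
  left to analyse for cocycle data.\<close>

lemma bilinear_extension_bracket:
  assumes "vector_space sL" and "vector_space sG"
    and la: "bilinear_map sG sL sG la" and ra: "bilinear_map sL sG sG ra"
    and f: "bilinear_map sL sL sG f"
  shows "bilinear_map (module_prod.scale sG sL) (module_prod.scale sG sL) (module_prod.scale sG sL)
    (extension_bracket la ra f)"
proof -
  interpret G: vector_space sG by fact
  interpret L: vector_space sL by fact
  interpret P: vector_space_prod sG sL ..
  note b = bilinear_map_simps(1,2)[OF la] bilinear_map_simps(1,2)[OF ra]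
    bilinear_map_simps(1,2)[OF f] bilinear_map_scale[OF la] bilinear_map_scale[OF ra] bilinear_map_scale[OF f]
  show ?thesis
    unfolding bilinear_map_def
    by (auto intro!: Vector_Spaces.linear_iff[THEN iffD2] P.p.vector_space_axioms
        simp: extension_bracket_def P.scale_def b G.scale_right_distrib algebra_simps)
qed

lemma ZL2_iff:
  fixes sL :: "'k::field \<Rightarrow> 'l::ab_group_add \<Rightarrow> 'l"
    and sG :: "'k \<Rightarrow> 'g::ab_group_add \<Rightarrow> 'g"
  assumes vs: "vector_space sL" "vector_space sG"
  shows "(la, ra, f) \<in> ZL2 sL sG \<longleftrightarrow>
    (la, ra) \<in> discrete_reps sL sG \<and> f \<in> DZL2 sL sG (la, ra)"
\<comment> \<open>If one of the three maps fails to be bilinear, both sides are false.\<close>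
proof (cases "bilinear_map sG sL sG la \<and> bilinear_map sL sG sG ra \<and> bilinear_map sL sL sG f")
  case False
  then show ?thesis
    by (auto simp: ZL2_def discrete_reps_def DZL2_def)
next
  case True
  then have la: "bilinear_map sG sL sG la" and ra: "bilinear_map sL sG sG ra"
    and f: "bilinear_map sL sL sG f"
    by auto
  interpret G: vector_space sG by fact
  interpret L: vector_space sL by fact
  interpret P: vector_space_prod sG sL ..
  note b = bilinear_map_simps[OF la] bilinear_map_simps[OF ra] bilinear_map_simps[OF f]
  \<comment> \<open>This is the \<open>'g\<close>-component of the Leibniz identity at
    \<open>(g, x)\<close>, \<open>(h, y)\<close>, \<open>(l, z)\<close>; the
    \<open>'l\<close>-component reads \<open>0 = 0\<close>.\<close>
  let ?I = "\<forall>g x h y l z. ra x (ra y l) + ra x (la h z) + ra x (f y z) =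
    la (ra x h) z + la (la g y) z + la (f x y) z - (la (ra x l) y + la (la g z) y + la (f x z) y)"
  have "leibniz_algebra (module_prod.scale sG sL) (extension_bracket la ra f) \<longleftrightarrow> ?I"
    using bilinear_extension_bracket[OF vs la ra f] P.p.vector_space_axioms
    by (simp add: leibniz_algebra_def leibniz_algebra_axioms_def extension_bracket_def b)
  also have "\<dots> \<longleftrightarrow> (\<forall>g x y. la (la g x) y = la (la g y) x) \<and>
      (\<forall>g x y. ra x (la g y) = la (ra x g) y \<and> la (ra x g) y = - ra x (ra y g)) \<and>
      (\<forall>x y z. ra x (f y z) = la (f x y) z - la (f x z) y)" (is "_ \<longleftrightarrow> ?R")
  proof
    assume I: ?I
    have f0: "ra x (f y z) = la (f x y) z - la (f x z) y" for x y z
      using I[rule_format, where g = 0 and h = 0 and l = 0 and x = x and y = y and z = z]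
      by (simp add: b)
    \<comment> \<open>In this and the next two specializations one \<open>'l\<close>-argument is
      zero, which kills every term in \<open>f\<close>; the one nonzero \<open>'g\<close>-argument
      selects the axiom.\<close>
    moreover have "la (la g x) y = la (la g y) x" for g x y
      using I[rule_format, where g = g and h = 0 and l = 0 and x = 0 and y = x and z = y]
      by (simp add: b)
    moreover have "ra x (la g y) = la (ra x g) y" for g x y
      using I[rule_format, where g = 0 and h = g and l = 0 and x = x and y = 0 and z = y]
      by (simp add: b)
    moreover have "la (ra x g) y = - ra x (ra y g)" for g x y
      using I[rule_format, where g = 0 and h = 0 and l = g and x = x and y = y and z = 0]
      by (simp add: b)
    ultimately show ?R
      by blast
  next
    assume R: ?R
    show ?I
    proof (intro allI)
      fix g x h y l z
      \<comment> \<open>These account for the terms in \<open>g\<close>, \<open>h\<close>,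
        \<open>l\<close> and \<open>f\<close> respectively; together they give
        \<open>?I\<close>.\<close>
      have "la (la g y) z = la (la g z) y" "ra x (la h z) = la (ra x h) z"
        "la (ra x l) y = - ra x (ra y l)" "ra x (f y z) = la (f x y) z - la (f x z) y"
        using R by blast+
      then show "ra x (ra y l) + ra x (la h z) + ra x (f y z) = la (ra x h) z + la (la g y) z +
          la (f x y) z - (la (ra x l) y + la (la g z) y + la (f x z) y)"
        by simp
    qed
  qed
  finally show ?thesis
    using la ra f by (simp add: ZL2_def discrete_reps_def DZL2_def)
qed

text \<open>Related data share their actions, so a class of triples is a discrete class with the
  fixed pair \<open>(la, ra)\<close> attached to each member.\<close>

lemma HL2_rel_Image:
  assumes "vector_space sL" and "vector_space sG" and "(la, ra) \<in> discrete_reps sL sG"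
  shows "HL2_rel sL sG `` {(la, ra, f)} =
    (\<lambda>f'. (la, ra, f')) ` (DHL2_rel sL sG (la, ra) `` {f})"
  using assms by (auto simp: HL2_rel_def DHL2_rel_def ZL2_iff)

theorem corollary2p10:
  fixes sL :: "'k::field \<Rightarrow> 'l::ab_group_add \<Rightarrow> 'l"
    and sG :: "'k \<Rightarrow> 'g::ab_group_add \<Rightarrow> 'g"
  assumes "vector_space sL" and "vector_space sG"
  shows "\<exists>\<Phi>. bij_betw \<Phi> (SIGMA a : discrete_reps sL sG. DHL2 sL sG a) (HL2 sL sG) \<and>
    (\<forall>(la, ra) \<in> discrete_reps sL sG. \<forall>f \<in> DZL2 sL sG (la, ra).
      \<Phi> ((la, ra), DHL2_rel sL sG (la, ra) `` {f}) = HL2_rel sL sG `` {(la, ra, f)})"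
proof -
  let ?S = "SIGMA a : discrete_reps sL sG. DHL2 sL sG a"
  \<comment> \<open>Acting on whole classes as sets avoids choosing representatives, so there is no
    well-definedness to check.\<close>
  define \<Phi> :: "('l, 'g) actions \<times> ('l, 'g) cochain2 set \<Rightarrow> ('l, 'g) datum set"
    where "\<Phi> = (\<lambda>((la, ra), C). (\<lambda>f. (la, ra, f)) ` C)"
  have \<Phi>: "\<Phi> ((la, ra), DHL2_rel sL sG (la, ra) `` {f}) = HL2_rel sL sG `` {(la, ra, f)}"
    if "(la, ra) \<in> discrete_reps sL sG" for la ra f
    using HL2_rel_Image[OF assms that] by (simp add: \<Phi>_def)
  have "inj_on \<Phi> ?S"
  proof (rule inj_onI)
    fix p q assume p: "p \<in> ?S" and q: "q \<in> ?S" and eq: "\<Phi> p = \<Phi> q"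
    obtain la ra C la' ra' C' where pq: "p = ((la, ra), C)" "q = ((la', ra'), C')"
      by (metis surj_pair)
    \<comment> \<open>The actions are read off from a member of the image; the image of an empty
      class would lose them.\<close>
    have "C \<noteq> {}"
      using p in_quotient_imp_non_empty[OF equiv_DHL2_rel[OF assms]] by (auto simp: pq DHL2_def)
    moreover have eq': "(\<lambda>f. (la, ra, f)) ` C = (\<lambda>f. (la', ra', f)) ` C'"
      using eq by (simp add: pq \<Phi>_def)
    ultimately have "la = la'" "ra = ra'"
      by blast+
    moreover from this have "C = C'"
      using eq' by (simp add: inj_image_eq_iff inj_def)
    ultimately show "p = q"
      by (simp add: pq)
  qed
  moreover have "\<Phi> ` ?S = HL2 sL sG"
  proof
    show "\<Phi> ` ?S \<subseteq> HL2 sL sG"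
      by (auto simp: DHL2_def HL2_def \<Phi> ZL2_iff[OF assms] elim!: quotientE intro!: quotientI)
    show "HL2 sL sG \<subseteq> \<Phi> ` ?S"
    proof
      fix D assume "D \<in> HL2 sL sG"
      then obtain la ra f where "(la, ra, f) \<in> ZL2 sL sG" and D: "D = HL2_rel sL sG `` {(la, ra, f)}"
        by (auto simp: HL2_def elim!: quotientE)
      then have a: "(la, ra) \<in> discrete_reps sL sG" and f: "f \<in> DZL2 sL sG (la, ra)"
        by (auto simp: ZL2_iff[OF assms])
      then have "((la, ra), DHL2_rel sL sG (la, ra) `` {f}) \<in> ?S"
        by (auto simp: DHL2_def intro: quotientI)
      then show "D \<in> \<Phi> ` ?S"
        unfolding D \<Phi>[OF a, symmetric] by (rule imageI)
    qed
  qed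
  ultimately show ?thesis
    using \<Phi> by (intro exI[of _ \<Phi>]) (auto simp: bij_betw_def)
qed

end
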